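(* Let $\Gamma$ be a connected regular graph on $v$ vertices that is not a complete multipartite graph, and let $\theta_m,\theta_M$ be as defined in the context. Let $\theta_{Max2}$ be the second largest eigenvalue and $\theta_{min}$ the smallest eigenvalue of the adjacency matrix of $\Gamma$. Then (a) $\theta_{min}\le \theta_m$, with equality if and only if $\Gamma$ is strongly regular; and (b) $\theta_{Max2}\ge\theta_M$, with equality if and only if $\Gamma$ is strongly regular.
   Context: Complete graphs and edgeless graphs count as complete multipartite graphs. For a graph $\Gamma=(V,E)$ on $v$ vertices, let $\bar k=2|E|/v$ (the average degree), let $N$ be the number of triangles of $\Gamma$, and $\bar\lambda=\frac{6N}{v\bar k}$. Define $$\bar s=\frac{-(\bar k^2-\bar k+\bar\lambda-\bar\lambda v)+\sqrt{(\bar k^2-\bar k+\bar\lambda-\bar\lambda v)^2+4\bar k(v-\bar k-1)(v+\bar\lambda-2\bar k)}}{2(v+\bar\lambda-2\bar k)},$$ $\bar\mu=\frac{\bar k(\bar k-\bar\lambda-1)}{v-\bar k-1}$, $\theta_m=-\frac{\bar k}{\bar s}$ and $\theta_M=\frac{\bar k-\bar\mu}{\bar k}\bar s$. *)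

theory Defs
  imports
    "HOL-Library.Disjoint_Sets"
    "Graph_Theory.Digraph"
    "Graph_Theory.Digraph_Component"
    "Jordan_Normal_Form.Char_Poly"
begin

text \<open>
  Finite simple graphs are the \<^locale>\<open>graph\<close>s: finite symmetric digraphs
  without loops and parallel arcs.  Each undirected edge is a pair of opposite arcs, so edges and
  triangles are counted below as sets of vertices.
\<close>

definition edges :: "('a, 'b) pre_digraph \<Rightarrow> 'a set set" where
  "edges G = {{u, v} | u v. u \<rightarrow>\<^bsub>G\<^esub> v}"

definition triangles :: "('a, 'b) pre_digraph \<Rightarrow> 'a set set" where
  "triangles G = {{u, v, w} | u v w. u \<rightarrow>\<^bsub>G\<^esub> v \<and> v \<rightarrow>\<^bsub>G\<^esub> w \<and> w \<rightarrow>\<^bsub>G\<^esub> u}"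

definition regular :: "('a, 'b) pre_digraph \<Rightarrow> bool" where
  "regular G \<longleftrightarrow> (\<exists>k. \<forall>u \<in> verts G. out_degree G u = k)"

text \<open>
  Any number of parts is allowed: singleton parts give the complete graphs, a single part gives
  the edgeless graphs.
\<close>

definition complete_multipartite :: "('a, 'b) pre_digraph \<Rightarrow> bool" where
  "complete_multipartite G \<longleftrightarrow>
     (\<exists>P. partition_on (verts G) P \<and>
          (\<forall>u \<in> verts G. \<forall>v \<in> verts G. u \<rightarrow>\<^bsub>G\<^esub> v \<longleftrightarrow> \<not> (\<exists>X \<in> P. u \<in> X \<and> v \<in> X)))"

definition common_neighbours :: "('a, 'b) pre_digraph \<Rightarrow> 'a \<Rightarrow> 'a \<Rightarrow> 'a set" where
  "common_neighbours G u v = {w \<in> verts G. u \<rightarrow>\<^bsub>G\<^esub> w \<and> v \<rightarrow>\<^bsub>G\<^esub> w}"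

text \<open>
  Complete and edgeless graphs are often excluded by convention; they are complete multipartite,
  so the convention is immaterial for graphs that are not complete multipartite.
\<close>

definition strongly_regular :: "('a, 'b) pre_digraph \<Rightarrow> bool" where
  "strongly_regular G \<longleftrightarrow>
     (\<exists>k l m.
        (\<forall>u \<in> verts G. out_degree G u = k) \<and>
        (\<forall>u \<in> verts G. \<forall>v \<in> verts G. u \<rightarrow>\<^bsub>G\<^esub> v \<longrightarrow> card (common_neighbours G u v) = l) \<and>
        (\<forall>u \<in> verts G. \<forall>v \<in> verts G. u \<noteq> v \<and> \<not> u \<rightarrow>\<^bsub>G\<^esub> v \<longrightarrow>
           card (common_neighbours G u v) = m))"

definition num_verts :: "('a, 'b) pre_digraph \<Rightarrow> real" where
  "num_verts G = real (card (verts G))"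

definition k_bar :: "('a, 'b) pre_digraph \<Rightarrow> real" where
  "k_bar G = 2 * real (card (edges G)) / num_verts G"

definition lambda_bar :: "('a, 'b) pre_digraph \<Rightarrow> real" where
  "lambda_bar G = 6 * real (card (triangles G)) / (num_verts G * k_bar G)"

definition s_bar :: "('a, 'b) pre_digraph \<Rightarrow> real" where
  "s_bar G =
     (let v = num_verts G; k = k_bar G; l = lambda_bar G; b = k\<^sup>2 - k + l - l * v
      in (- b + sqrt (b\<^sup>2 + 4 * k * (v - k - 1) * (v + l - 2 * k))) / (2 * (v + l - 2 * k)))"

definition mu_bar :: "('a, 'b) pre_digraph \<Rightarrow> real" where
  "mu_bar G = k_bar G * (k_bar G - lambda_bar G - 1) / (num_verts G - k_bar G - 1)"

definition theta_m :: "('a, 'b) pre_digraph \<Rightarrow> real" where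
  "theta_m G = - (k_bar G / s_bar G)"

definition theta_M :: "('a, 'b) pre_digraph \<Rightarrow> real" where
  "theta_M G = (k_bar G - mu_bar G) / k_bar G * s_bar G"

text \<open>The list \<open>vs\<close> is an enumeration of the vertices, fixing the order of rows and columns.\<close>

definition adjacency_matrix :: "('a, 'b) pre_digraph \<Rightarrow> 'a list \<Rightarrow> real mat" where
  "adjacency_matrix G vs =
     mat (length vs) (length vs) (\<lambda>(i, j). if vs ! i \<rightarrow>\<^bsub>G\<^esub> vs ! j then 1 else 0)"

text \<open>
  The real eigenvalues in decreasing order, repeated according to algebraic multiplicity.  For a
  real symmetric matrix, these are all the eigenvalues.
\<close>

definition eigenvalue_list :: "real mat \<Rightarrow> real list" where
  "eigenvalue_list A = rev (sorted_list_of_multiset (proots (char_poly A)))"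

definition theta_Max2 :: "real mat \<Rightarrow> real" where
  "theta_Max2 A = eigenvalue_list A ! 1"

definition theta_min :: "real mat \<Rightarrow> real" where
  "theta_min A = last (eigenvalue_list A)"

end

theory Submission
  imports Defs "Jordan_Normal_Form.Schur_Decomposition"
begin

text \<open>
  Let \<open>k\<close> be the valency and \<open>q(x) = (x - \<theta>\<^sub>m) (x - \<theta>\<^sub>M) = x\<^sup>2 - (\<lambda> - \<mu>) x + (\<mu> - k)\<close>, with the averaged
  parameters.  The traces of the first three powers of the adjacency matrix \<open>A\<close> show that \<open>q\<close> is
  orthogonal to \<open>1\<close> and \<open>x\<close> with respect to the uniform measure on the non-principal eigenvalues.
  Hence the sum of \<open>(t - \<theta>\<^sub>m) (t - \<theta>\<^sub>M)\<^sup>2\<close> over these eigenvalues vanishes, so one of them is at most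
  \<open>\<theta>\<^sub>m\<close>, and if none is smaller then \<open>q\<close> vanishes on all of them; symmetrically for \<open>\<theta>\<^sub>M\<close>.  Finally,
  the sum of \<open>q(t)\<^sup>2\<close> over the non-principal eigenvalues is the squared Frobenius norm of
  \<open>q(A) - (q(k) / v) J\<close>, which vanishes if and only if the graph is strongly regular.
\<close>

section \<open>Spectra of real symmetric matrices\<close>

lemma index_mult_mat_sum:
  assumes "A \<in> carrier_mat n m" "B \<in> carrier_mat m p" "i < n" "j < p"
  shows "(A * B) $$ (i, j) = (\<Sum>k<m. A $$ (i, k) * B $$ (k, j))"
  using assms by (auto simp: scalar_prod_def atLeast0LessThan intro!: sum.cong)

lemma trace_mult_commute:
  fixes A B :: "'a :: comm_semiring_0 mat"
  assumes "A \<in> carrier_mat n m" "B \<in> carrier_mat m n"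
  shows "(\<Sum>i<n. (A * B) $$ (i, i)) = (\<Sum>i<m. (B * A) $$ (i, i))"
proof -
  have "(\<Sum>i<n. (A * B) $$ (i, i)) = (\<Sum>i<n. \<Sum>k<m. A $$ (i, k) * B $$ (k, i))"
    using assms by (intro sum.cong) (auto simp: index_mult_mat_sum simp del: index_mult_mat)
  also have "\<dots> = (\<Sum>k<m. \<Sum>i<n. B $$ (k, i) * A $$ (i, k))"
    by (subst sum.swap) (simp add: mult.commute)
  also have "\<dots> = (\<Sum>i<m. (B * A) $$ (i, i))"
    using assms by (intro sum.cong) (auto simp: index_mult_mat_sum simp del: index_mult_mat)
  finally show ?thesis .
qed

lemma upper_triangular_pow:
  fixes A :: "'a :: semiring_1 mat"
  assumes A: "A \<in> carrier_mat n n" and ut: "upper_triangular A"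
  shows "upper_triangular (A ^\<^sub>m m) \<and> (\<forall>i<n. (A ^\<^sub>m m) $$ (i, i) = (A $$ (i, i)) ^ m)"
proof (induction m)
  case 0
  show ?case using A by auto
next
  case (Suc m)
  have P: "A ^\<^sub>m m \<in> carrier_mat n n" using A by simp
  have low: "A $$ (i, j) = 0" "(A ^\<^sub>m m) $$ (i, j) = 0" if "j < i" "i < n" for i j
    using that Suc ut A P by auto
  have entry: "(A ^\<^sub>m Suc m) $$ (i, j) = (\<Sum>k<n. (A ^\<^sub>m m) $$ (i, k) * A $$ (k, j))"
    if "i < n" "j < n" for i j
    using that index_mult_mat_sum[OF P A] by simp
  have "(A ^\<^sub>m Suc m) $$ (i, j) = 0" if "j < i" "i < n" for i j
  proof -
    have "(A ^\<^sub>m m) $$ (i, k) * A $$ (k, j) = 0" if "k < n" for k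
      using low[of k i] low[of j k] that \<open>j < i\<close> \<open>i < n\<close> by (cases "k < i") auto
    then show ?thesis using that by (simp add: entry del: pow_mat.simps)
  qed
  moreover have "(A ^\<^sub>m Suc m) $$ (i, i) = (A $$ (i, i)) ^ Suc m" if "i < n" for i
  proof -
    \<comment> \<open>Each term with \<open>k\<close> different from \<open>i\<close> has a factor
      below the diagonal: the first for \<open>k < i\<close>, the second for
      \<open>k > i\<close>.\<close>
    have "(A ^\<^sub>m m) $$ (i, k) * A $$ (k, i) = (if k = i then (A $$ (i, i)) ^ Suc m else 0)"
      if "k < n" for k
    proof (cases "k < i")
      case True
      then show ?thesis using low[of k i] \<open>i < n\<close> by simp
    next
      case False
      then show ?thesis using low[of i k] that Suc by (auto simp: power_commutes)
    qed
    then show ?thesis using that by (simp add: entry del: pow_mat.simps)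
  qed
  ultimately show ?case using A by auto
qed

text \<open>Schur decomposition makes \<open>A\<close> similar to a triangular matrix with diagonal
  \<open>es\<close>. Similarity passes to powers and the trace is cyclic, so only the diagonal of
  the triangular power contributes.\<close>

lemma trace_pow_eq_power_sum:
  fixes A :: "'a :: conjugatable_ordered_field mat"
  assumes A: "A \<in> carrier_mat n n"
    and cp: "char_poly A = (\<Prod>e \<leftarrow> es. [:- e, 1:])"
  shows "(\<Sum>i<n. (A ^\<^sub>m m) $$ (i, i)) = (\<Sum>e \<leftarrow> es. e ^ m)"
proof -
  obtain B P Q where "schur_decomposition A es = (B, P, Q)"
    by (cases "schur_decomposition A es") auto
  with schur_decomposition[OF A cp] have wit: "similar_mat_wit A B P Q"
    and ut: "upper_triangular B" and diag: "diag_mat B = es" by auto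
  note w = similar_mat_witD2[OF A wit]
  have pow: "A ^\<^sub>m m = P * (B ^\<^sub>m m * Q)"
    using similar_mat_wit_pow_id[OF wit, of m] w by (simp add: assoc_mult_mat[of _ n n _ n _ n])
  have "(\<Sum>i<n. (A ^\<^sub>m m) $$ (i, i)) = (\<Sum>i<n. (B ^\<^sub>m m * Q * P) $$ (i, i))"
    unfolding pow using w by (intro trace_mult_commute) auto
  also have "B ^\<^sub>m m * Q * P = B ^\<^sub>m m"
    using w by (simp add: assoc_mult_mat[of _ n n _ n _ n])
  also have "(\<Sum>i<n. (B ^\<^sub>m m) $$ (i, i)) = (\<Sum>i<n. (B $$ (i, i)) ^ m)"
    using upper_triangular_pow[OF w(5) ut, of m] by (intro sum.cong) auto
  also have "\<dots> = (\<Sum>e \<leftarrow> es. e ^ m)"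
    unfolding diag[symmetric] using w(5)
    by (simp add: diag_mat_def sum_list_sum_nth atLeast0LessThan)
  finally show ?thesis .
qed

text \<open>The Hermitian form of \<open>A\<close> at an eigenvector \<open>v\<close> is
  \<open>z\<close> times the squared norm of \<open>v\<close>. It is its own conjugate because
  \<open>A\<close> is real and symmetric, and the norm is nonzero.\<close>

lemma eigenvalue_of_symmetric_real:
  fixes A :: "real mat"
  assumes A: "A \<in> carrier_mat n n" and sym: "transpose_mat A = A"
    and ev: "eigenvalue (map_mat complex_of_real A) z"
  shows "z \<in> \<real>"
proof -
  obtain v where "eigenvector (map_mat complex_of_real A) v z"
    using ev by (auto simp: eigenvalue_def)
  then have v: "v \<in> carrier_vec n" "v \<noteq> 0\<^sub>v n"
    and Av: "map_mat complex_of_real A *\<^sub>v v = z \<cdot>\<^sub>v v"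
    using A by (auto simp: eigenvector_def)
  have symA: "A $$ (j, i) = A $$ (i, j)" if "i < n" "j < n" for i j
    using arg_cong[OF sym, of "\<lambda>M. M $$ (i, j)"] that A by simp
  have row: "(\<Sum>j<n. of_real (A $$ (i, j)) * v $ j) = z * v $ i" if "i < n" for i
    using arg_cong[OF Av, of "\<lambda>w. w $ i"] that A v
    by (simp add: scalar_prod_def atLeast0LessThan)
  define S where "S = (\<Sum>i<n. \<Sum>j<n. cnj (v $ i) * (of_real (A $$ (i, j)) * v $ j))"
  define N where "N = (\<Sum>i<n. (cmod (v $ i))\<^sup>2)"
  have "S = (\<Sum>i<n. cnj (v $ i) * (z * v $ i))"
    unfolding S_def sum_distrib_left[symmetric] by (simp add: row)
  also have "\<dots> = z * of_real N"
    unfolding N_def of_real_sum sum_distrib_left complex_norm_square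
    by (intro sum.cong) (auto simp: mult_ac)
  finally have S: "S = z * of_real N" .
  have "cnj S = (\<Sum>i<n. \<Sum>j<n. cnj (v $ j) * (of_real (A $$ (j, i)) * v $ i))"
    unfolding S_def cnj_sum by (intro sum.cong) (auto simp: mult_ac symA)
  also have "\<dots> = S"
    unfolding S_def by (rule sum.swap)
  finally have "cnj z * of_real N = z * of_real N"
    using S by simp
  moreover have "N \<noteq> 0"
  proof -
    obtain i where "i < n" "v $ i \<noteq> 0" using v by force
    then have "(cmod (v $ i))\<^sup>2 > 0" by simp
    also have "(cmod (v $ i))\<^sup>2 \<le> N"
      unfolding N_def using \<open>i < n\<close> by (intro member_le_sum) auto
    finally show ?thesis by simp
  qed
  ultimately show ?thesis by (simp add: Reals_cnj_iff)
qed

text \<open>The characteristic polynomial splits over the complex numbers and its roots are real by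
  \<open>eigenvalue_of_symmetric_real\<close>. The factorization descends because the embedding of
  real polynomials is injective.\<close>

lemma char_poly_symmetric_splits:
  fixes A :: "real mat"
  assumes A: "A \<in> carrier_mat n n" and sym: "transpose_mat A = A"
  obtains es where "char_poly A = (\<Prod>e \<leftarrow> es. [:- e, 1:])"
proof -
  let ?A = "map_mat complex_of_real A"
  have cA: "?A \<in> carrier_mat n n" using A by simp
  interpret h: map_poly_inj_comm_ring_hom complex_of_real ..
  obtain zs where zs: "char_poly ?A = (\<Prod>z \<leftarrow> zs. [:- z, 1:])"
    using char_poly_factorized[OF cA] by blast
  have "z \<in> \<real>" if "z \<in> set zs" for z
  proof -
    have "poly (char_poly ?A) z = 0"
      unfolding zs using that by (induction zs) auto
    then show ?thesis
      using eigenvalue_of_symmetric_real[OF A sym] eigenvalue_root_char_poly[OF cA] by blast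
  qed
  then have "zs = map (complex_of_real \<circ> Re) zs"
    by (induction zs) auto
  then have "map_poly complex_of_real (char_poly A) =
      (\<Prod>z \<leftarrow> map (complex_of_real \<circ> Re) zs. [:- z, 1:])"
    using zs of_real_hom.char_poly_hom[OF A] by metis
  also have "\<dots> = map_poly complex_of_real (\<Prod>e \<leftarrow> map Re zs. [:- e, 1:])"
    by (simp add: h.hom_prod_list comp_def)
  finally have "char_poly A = (\<Prod>e \<leftarrow> map Re zs. [:- e, 1:])"
    by simp
  then show ?thesis by (rule that)
qed

text \<open>\<open>eigenvalue_list\<close> collects real roots only. The splitting guarantees that
  all \<open>n\<close> eigenvalues occur in it with multiplicity, so traces of powers become power
  sums of this list.\<close>

lemma eigenvalue_list_of_symmetric:
  assumes A: "A \<in> carrier_mat n n" and sym: "transpose_mat A = A"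
  shows "char_poly A = (\<Prod>e \<leftarrow> eigenvalue_list A. [:- e, 1:])"
    and "length (eigenvalue_list A) = n"
proof -
  obtain es where es: "char_poly A = (\<Prod>e \<leftarrow> es. [:- e, 1:])"
    using char_poly_symmetric_splits[OF assms] .
  have "proots (char_poly A) = mset es"
    unfolding es
  proof (induction es)
    case (Cons e es)
    have "(\<Prod>e \<leftarrow> es. [:- e, 1:]) \<noteq> 0" by auto
    then show ?case using Cons by (simp add: proots_mult del: mult_pCons_left)
  qed simp
  then have mset: "mset (eigenvalue_list A) = mset es"
    by (simp add: eigenvalue_list_def)
  then have "(\<Prod>e \<leftarrow> eigenvalue_list A. [:- e, 1:]) = (\<Prod>e \<leftarrow> es. [:- e, 1:])"
    by (metis mset_map prod_mset_prod_list)
  then show "char_poly A = (\<Prod>e \<leftarrow> eigenvalue_list A. [:- e, 1:])"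
    using es by simp
  have "length es = n"
    using degree_monic_char_poly[OF A] degree_linear_factors[of uminus es] es by simp
  then show "length (eigenvalue_list A) = n"
    using mset mset_eq_length by metis
qed

lemma sorted_wrt_eigenvalue_list: "sorted_wrt (\<ge>) (eigenvalue_list A)"
  by (simp add: eigenvalue_list_def sorted_wrt_rev)

lemma eigenvalue_list_iff:
  assumes A: "A \<in> carrier_mat n n"
  shows "e \<in> set (eigenvalue_list A) \<longleftrightarrow> eigenvalue A e"
proof -
  have "char_poly A \<noteq> 0" using degree_monic_char_poly[OF A] by auto
  then show ?thesis using eigenvalue_root_char_poly[OF A]
    by (simp add: eigenvalue_list_def)
qed

section \<open>Inner products of matrix powers and constant row sums\<close>

lemma pow_mat_add:
  assumes "A \<in> carrier_mat n n"
  shows "A ^\<^sub>m (p + q) = A ^\<^sub>m p * A ^\<^sub>m q"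
  using assms
  by (induction q) (auto simp: assoc_mult_mat[of _ n n _ n _ n])

lemma transpose_pow_mat:
  fixes A :: "'a :: comm_semiring_1 mat"
  assumes A: "A \<in> carrier_mat n n"
  shows "transpose_mat (A ^\<^sub>m m) = transpose_mat A ^\<^sub>m m"
proof (induction m)
  case (Suc m)
  have "transpose_mat (A ^\<^sub>m Suc m) = transpose_mat A * transpose_mat (A ^\<^sub>m m)"
    using A by (simp add: transpose_mult[of _ n n _ n])
  also have "\<dots> = transpose_mat A ^\<^sub>m (1 + m)"
    using A pow_mat_add[of "transpose_mat A" n 1 m] Suc by simp
  finally show ?case by simp
qed (use A in simp)

text \<open>Powers of \<open>A\<close> are symmetric, so the entrywise inner product of two of them
  is the trace of their product.\<close>

lemma frobenius_pow_symmetric: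
  fixes A :: "'a :: comm_semiring_1 mat"
  assumes A: "A \<in> carrier_mat n n" and sym: "transpose_mat A = A"
  shows "(\<Sum>i<n. \<Sum>j<n. (A ^\<^sub>m p) $$ (i, j) * (A ^\<^sub>m q) $$ (i, j)) =
    (\<Sum>i<n. (A ^\<^sub>m (p + q)) $$ (i, i))"
proof -
  have "(A ^\<^sub>m q) $$ (j, i) = (A ^\<^sub>m q) $$ (i, j)" if "i < n" "j < n" for i j
    using arg_cong[OF transpose_pow_mat[OF A, of q], of "\<lambda>M. M $$ (i, j)"] that A sym
      pow_carrier_mat[OF A, of q] by auto
  then show ?thesis
    unfolding pow_mat_add[OF A]
    using A by (intro sum.cong) (auto simp: index_mult_mat_sum[of _ n n _ n]
        simp del: index_mult_mat intro!: sum.cong)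
qed

text \<open>The all-ones vector is an eigenvector of \<open>A\<close> for \<open>k\<close>, hence of
  the power for \<open>k ^ m\<close>; the induction is this fact in coordinates.\<close>

lemma row_sum_pow_mat:
  fixes A :: "'a :: comm_semiring_1 mat"
  assumes A: "A \<in> carrier_mat n n"
    and row: "\<And>i. i < n \<Longrightarrow> (\<Sum>j<n. A $$ (i, j)) = k"
    and "i < n"
  shows "(\<Sum>j<n. (A ^\<^sub>m m) $$ (i, j)) = k ^ m"
proof (induction m)
  case 0
  show ?case using A \<open>i < n\<close> by (simp add: one_mat_def)
next
  case (Suc m)
  have "(\<Sum>j<n. (A ^\<^sub>m Suc m) $$ (i, j)) = (\<Sum>j<n. \<Sum>l<n. (A ^\<^sub>m m) $$ (i, l) * A $$ (l, j))"
    using A \<open>i < n\<close>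
    by (intro sum.cong) (auto simp: index_mult_mat_sum[of _ n n _ n] simp del: index_mult_mat)
  also have "\<dots> = (\<Sum>l<n. (A ^\<^sub>m m) $$ (i, l) * k)"
    by (subst sum.swap) (simp add: row flip: sum_distrib_left)
  also have "\<dots> = k ^ Suc m"
    unfolding sum_distrib_right[symmetric] Suc by (simp add: mult.commute)
  finally show ?case .
qed

lemma eigenvalue_row_sum:
  fixes A :: "'a :: field mat"
  assumes A: "A \<in> carrier_mat n n" and "n > 0"
    and row: "\<And>i. i < n \<Longrightarrow> (\<Sum>j<n. A $$ (i, j)) = k"
  shows "eigenvalue A k"
proof -
  define v :: "'a vec" where "v = vec n (\<lambda>_. 1)"
  have "v $ 0 \<noteq> 0\<^sub>v n $ 0" using \<open>n > 0\<close> by (simp add: v_def)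
  moreover have "A *\<^sub>v v = k \<cdot>\<^sub>v v"
    using A row by (intro eq_vecI) (auto simp: v_def scalar_prod_def atLeast0LessThan)
  ultimately have "eigenvector A v k"
    using A by (auto simp: eigenvector_def v_def)
  then show ?thesis by (auto simp: eigenvalue_def)
qed

text \<open>At a coordinate where the eigenvector has largest absolute value, the nonnegative row
  bounds the absolute value of the product by \<open>k\<close> times that maximum.\<close>

lemma eigenvalue_le_row_sum:
  fixes A :: "real mat"
  assumes A: "A \<in> carrier_mat n n"
    and nonneg: "\<And>i j. i < n \<Longrightarrow> j < n \<Longrightarrow> A $$ (i, j) \<ge> 0"
    and row: "\<And>i. i < n \<Longrightarrow> (\<Sum>j<n. A $$ (i, j)) = k"
    and "eigenvalue A e"
  shows "e \<le> k"
proof -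
  obtain v where v: "v \<in> carrier_vec n" "v \<noteq> 0\<^sub>v n" and Av: "A *\<^sub>v v = e \<cdot>\<^sub>v v"
    using \<open>eigenvalue A e\<close> A by (auto simp: eigenvalue_def eigenvector_def)
  obtain l where l: "l < n" "v $ l \<noteq> 0" using v by force
  have "Max ((\<lambda>i. \<bar>v $ i\<bar>) ` {..<n}) \<in> (\<lambda>i. \<bar>v $ i\<bar>) ` {..<n}"
    using l by (intro Max_in) auto
  then obtain i where "i < n" and i: "Max ((\<lambda>i. \<bar>v $ i\<bar>) ` {..<n}) = \<bar>v $ i\<bar>" by auto
  have max: "\<bar>v $ j\<bar> \<le> \<bar>v $ i\<bar>" if "j < n" for j
    unfolding i[symmetric] using that by simp
  have "\<bar>v $ i\<bar> > 0" using max[of l] l by auto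
  have "e * v $ i = (\<Sum>j<n. A $$ (i, j) * v $ j)"
    using arg_cong[OF Av, of "\<lambda>w. w $ i"] \<open>i < n\<close> A v
    by (simp add: scalar_prod_def atLeast0LessThan)
  then have "\<bar>e\<bar> * \<bar>v $ i\<bar> = \<bar>\<Sum>j<n. A $$ (i, j) * v $ j\<bar>"
    by (metis abs_mult)
  also have "\<dots> \<le> (\<Sum>j<n. \<bar>A $$ (i, j) * v $ j\<bar>)" by (rule sum_abs)
  also have "\<dots> \<le> (\<Sum>j<n. A $$ (i, j) * \<bar>v $ i\<bar>)"
    using nonneg \<open>i < n\<close> max by (intro sum_mono) (simp add: abs_mult mult_left_mono)
  also have "\<dots> = k * \<bar>v $ i\<bar>"
    using row \<open>i < n\<close> by (simp flip: sum_distrib_right)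
  finally show ?thesis using \<open>\<bar>v $ i\<bar> > 0\<close> by simp
qed

text \<open>One copy of the principal eigenvalue is split off. Further copies of \<open>k\<close>,
  if any, stay in \<open>ts\<close>, so the head of a nonempty \<open>ts\<close> is the second
  largest eigenvalue counted with multiplicity.\<close>

lemma eigenvalue_list_row_sum:
  assumes A: "A \<in> carrier_mat n n" and sym: "transpose_mat A = A" and "n > 0"
    and "\<And>i j. i < n \<Longrightarrow> j < n \<Longrightarrow> A $$ (i, j) \<ge> 0"
    and row: "\<And>i. i < n \<Longrightarrow> (\<Sum>j<n. A $$ (i, j)) = k"
  obtains ts where "eigenvalue_list A = k # ts"
proof -
  have k: "k \<in> set (eigenvalue_list A)"
    and le: "\<And>e. e \<in> set (eigenvalue_list A) \<Longrightarrow> e \<le> k"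
    using assms by (auto simp: eigenvalue_list_iff[OF A] eigenvalue_row_sum
        intro: eigenvalue_le_row_sum)
  obtain e ts where es: "eigenvalue_list A = e # ts"
    using k by (cases "eigenvalue_list A") auto
  have "e = k"
    using k le[of e] sorted_wrt_eigenvalue_list[of A] unfolding es by auto
  then show ?thesis using es that by blast
qed

text \<open>Subtracting the multiple of the all-ones matrix removes the eigenvalue of the all-ones vector.\<close>

lemma frobenius_quadratic_minus_const:
  fixes A :: "real mat" and s p k :: real
  assumes A: "A \<in> carrier_mat n n" and sym: "transpose_mat A = A" and "n > 0"
    and row: "\<And>i. i < n \<Longrightarrow> (\<Sum>j<n. A $$ (i, j)) = k"
    and cp: "char_poly A = (\<Prod>e \<leftarrow> k # ts. [:- e, 1:])"
  defines "q \<equiv> \<lambda>x. x\<^sup>2 - s * x + p"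
  defines "M \<equiv> \<lambda>i j. (A ^\<^sub>m 2) $$ (i, j) - s * A $$ (i, j) + p * (1\<^sub>m n) $$ (i, j)"
  shows "(\<Sum>i<n. \<Sum>j<n. (M i j - q k / n)\<^sup>2) = (\<Sum>t\<leftarrow>ts. (q t)\<^sup>2)"
proof -
  define P where "P a = (\<Sum>e\<leftarrow>k # ts. e ^ a)" for a
  have F: "(\<Sum>i<n. \<Sum>j<n. (A ^\<^sub>m a) $$ (i, j) * (A ^\<^sub>m b) $$ (i, j)) = P (a + b)" for a b
    unfolding P_def using frobenius_pow_symmetric[OF A sym] trace_pow_eq_power_sum[OF A cp] by simp
  have A0: "A ^\<^sub>m 0 = 1\<^sub>m n" and A1: "A ^\<^sub>m 1 = A" using A by auto
  have M: "M i j = (A ^\<^sub>m 2) $$ (i, j) - s * (A ^\<^sub>m 1) $$ (i, j) + p * (A ^\<^sub>m 0) $$ (i, j)" for i j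
    unfolding M_def A0 A1 ..
  have sumM: "(\<Sum>i<n. \<Sum>j<n. M i j) = n * q k"
    unfolding M q_def using row_sum_pow_mat[OF A row]
    by (simp add: sum.distrib sum_subtractf flip: sum_distrib_left del: pow_mat.simps One_nat_def)
  \<comment> \<open>Expanding the square gives inner products of powers of \<open>A\<close>. By
    \<open>F\<close> these are power sums of the whole spectrum, with the same coefficients as in
    the square of \<open>q\<close>.\<close>
  have "(\<Sum>i<n. \<Sum>j<n. (M i j)\<^sup>2) =
      P (2 + 2) - 2 * s * P (2 + 1) + 2 * p * P (2 + 0) + s\<^sup>2 * P (1 + 1) -
      2 * s * p * P (1 + 0) + p\<^sup>2 * P (0 + 0)"
    unfolding M F[symmetric] sum_distrib_left sum.distrib[symmetric] sum_subtractf[symmetric]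
    by (intro sum.cong refl) (simp add: power2_eq_square algebra_simps)
  also have "\<dots> = (\<Sum>e\<leftarrow>k # ts. (q e)\<^sup>2)"
    unfolding P_def sum_list_const_mult[symmetric] sum_list_addf[symmetric] sum_list_subtractf[symmetric]
    by (intro arg_cong[of _ _ sum_list] map_cong refl)
      (simp add: q_def eval_nat_numeral algebra_simps)
  finally have sumM2: "(\<Sum>i<n. \<Sum>j<n. (M i j)\<^sup>2) = (\<Sum>e\<leftarrow>k # ts. (q e)\<^sup>2)" .
  define c where "c = q k / n"
  have "(\<Sum>i<n. \<Sum>j<n. (M i j - c)\<^sup>2) =
      (\<Sum>i<n. \<Sum>j<n. (M i j)\<^sup>2) - 2 * c * (\<Sum>i<n. \<Sum>j<n. M i j) + n * (n * c\<^sup>2)"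
    by (simp add: power2_diff sum.distrib sum_subtractf sum_distrib_left algebra_simps)
  \<comment> \<open>For \<open>c = q k / n\<close> the last two terms add up to minus the square of
    \<open>q k\<close>, which cancels the contribution of the head \<open>k\<close>.\<close>
  also have "\<dots> = (\<Sum>t\<leftarrow>ts. (q t)\<^sup>2)"
    unfolding sumM sumM2 c_def using \<open>n > 0\<close> by (simp add: field_simps power2_eq_square)
  finally show ?thesis unfolding c_def .
qed

section \<open>Two-point Gauss quadrature\<close>

text \<open>The two numbers are the roots of \<open>x\<^sup>2 - (l - m) * x + (m - k)\<close>. With
  \<open>e = v - k - 1\<close>, \<open>s\<close> is the positive root of
  \<open>d * s\<^sup>2 + b * s = k * e\<close>, while \<open>(k - m) / k = d / e\<close> and
  \<open>l - m = - b / e\<close>. Dividing the equation for \<open>s\<close> by \<open>e * s\<close>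
  gives the sum; the product is immediate.\<close>

lemma theta_sum_prod:
  fixes v k l :: real
  defines "b \<equiv> k\<^sup>2 - k + l - l * v" and "d \<equiv> v + l - 2 * k"
  defines "s \<equiv> (- b + sqrt (b\<^sup>2 + 4 * k * (v - k - 1) * d)) / (2 * d)"
  defines "m \<equiv> k * (k - l - 1) / (v - k - 1)"
  assumes "k > 0" "v - k - 1 > 0" "d > 0"
  shows "- (k / s) + (k - m) / k * s = l - m"
    and "- (k / s) * ((k - m) / k * s) = m - k"
    and "- (k / s) < 0" and "(k - m) / k * s > 0"
proof -
  define e where "e = v - k - 1"
  have e: "e > 0" and v: "v = e + k + 1" using assms by (auto simp: e_def)
  have pos: "4 * k * e * d > 0" using assms e by simp
  have sq: "(sqrt (b\<^sup>2 + 4 * k * e * d))\<^sup>2 = b\<^sup>2 + 4 * k * e * d"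
    using pos by (simp add: add_nonneg_nonneg)
  \<comment> \<open>The strict bound makes the numerator of \<open>s\<close> positive whatever the
    sign of \<open>b\<close>.\<close>
  have "\<bar>b\<bar> < sqrt (b\<^sup>2 + 4 * k * e * d)"
    using pos by (intro real_less_rsqrt) auto
  then have s_pos: "s > 0" using \<open>d > 0\<close> by (auto simp: s_def e_def)
  have s_eq: "2 * d * s + b = sqrt (b\<^sup>2 + 4 * k * e * d)"
    using \<open>d > 0\<close> by (simp add: s_def e_def)
  have "(2 * d * s + b)\<^sup>2 = b\<^sup>2 + 4 * k * e * d"
    unfolding s_eq sq ..
  then have "4 * d * (d * s\<^sup>2 + b * s - k * e) = 0"
    by (simp add: power2_eq_square algebra_simps)
  then have root: "d * s\<^sup>2 + b * s = k * e" using \<open>d > 0\<close> by simp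
  have me: "m * e = k * (k - l - 1)" using e by (simp add: m_def e_def)
  have km: "(k - m) * e = k * d"
    unfolding left_diff_distrib me by (simp add: d_def e_def algebra_simps)
  then have km': "(k - m) / k = d / e"
    using e \<open>k > 0\<close> by (simp add: field_simps)
  have lm: "(l - m) * e = - b"
    unfolding left_diff_distrib me by (simp add: b_def e_def power2_eq_square algebra_simps)
  have "(- (k / s) + d / e * s) * (e * s) = d * s\<^sup>2 - k * e"
    using e s_pos by (simp add: field_simps power2_eq_square)
  also have "\<dots> = (l - m) * (e * s)"
    using root lm by (simp add: mult.assoc[symmetric])
  finally show "- (k / s) + (k - m) / k * s = l - m"
    using e s_pos km' by simp
  show "- (k / s) * ((k - m) / k * s) = m - k"
    using \<open>k > 0\<close> s_pos by (simp add: field_simps)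
  show "- (k / s) < 0" using s_pos \<open>k > 0\<close> by simp
  show "(k - m) / k * s > 0" using km' \<open>d > 0\<close> e s_pos by simp
qed

lemma sum_list_shifted_orthogonal:
  fixes a b c :: real
  assumes "(\<Sum>t\<leftarrow>ts. (t - a) * (t - b)) = 0" and "(\<Sum>t\<leftarrow>ts. t * ((t - a) * (t - b))) = 0"
  shows "(\<Sum>t\<leftarrow>ts. (t - c) * ((t - a) * (t - b))) = 0"
proof -
  have "(\<Sum>t\<leftarrow>ts. (t - c) * ((t - a) * (t - b))) =
      (\<Sum>t\<leftarrow>ts. t * ((t - a) * (t - b))) - c * (\<Sum>t\<leftarrow>ts. (t - a) * (t - b))"
    by (simp add: left_diff_distrib sum_list_subtractf sum_list_const_mult)
  then show ?thesis using assms by simp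
qed

text \<open>Orthogonality to \<open>t - b\<close> makes the sum of
  \<open>(t - a) * (t - b)\<^sup>2\<close> vanish. Its terms are nonnegative when every
  \<open>t\<close> is at least \<open>a\<close>, so each of them is zero.\<close>

lemma gauss_nodes_if_ge:
  fixes a b :: real
  assumes "(\<Sum>t\<leftarrow>ts. (t - a) * (t - b)) = 0" "(\<Sum>t\<leftarrow>ts. t * ((t - a) * (t - b))) = 0"
    and ge: "\<And>t. t \<in> set ts \<Longrightarrow> a \<le> t"
    and "t \<in> set ts"
  shows "t = a \<or> t = b"
proof -
  have "(\<Sum>t\<leftarrow>ts. (t - b) * ((t - a) * (t - b))) = 0"
    using assms(1,2) by (rule sum_list_shifted_orthogonal)
  moreover have "(t - b) * ((t - a) * (t - b)) \<ge> 0" if "t \<in> set ts" for t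
  proof -
    have eq: "(t - b) * ((t - a) * (t - b)) = (t - a) * (t - b)\<^sup>2"
      by (simp only: power2_eq_square mult_ac)
    show ?thesis unfolding eq using ge[OF that] by simp
  qed
  ultimately have "\<forall>y\<in>set (map (\<lambda>t. (t - b) * ((t - a) * (t - b))) ts). y = 0"
    using sum_list_nonneg_eq_0_iff[of "map (\<lambda>t. (t - b) * ((t - a) * (t - b))) ts"] by force
  then show ?thesis using \<open>t \<in> set ts\<close> by auto
qed

lemma gauss_nodes_if_le:
  fixes a b :: real
  assumes s0: "(\<Sum>t\<leftarrow>ts. (t - a) * (t - b)) = 0"
    and s1: "(\<Sum>t\<leftarrow>ts. t * ((t - a) * (t - b))) = 0"
    and le: "\<And>t. t \<in> set ts \<Longrightarrow> t \<le> b"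
    and "t \<in> set ts"
  shows "t = a \<or> t = b"
proof -
  \<comment> \<open>Reflection at zero turns the upper bound \<open>b\<close> into the lower bound
    \<open>- b\<close> and exchanges the roles of the nodes.\<close>
  have "(\<Sum>t\<leftarrow>map uminus ts. (t - (- b)) * (t - (- a))) = 0"
    using s0 by (simp add: comp_def algebra_simps)
  moreover have "(\<Sum>t\<leftarrow>map uminus ts. t * ((t - (- b)) * (t - (- a)))) = - (\<Sum>t\<leftarrow>ts. t * ((t - a) * (t - b)))"
    unfolding uminus_sum_list_map by (simp add: comp_def algebra_simps)
  ultimately have "- t = - b \<or> - t = - a"
    using s1 le \<open>t \<in> set ts\<close> by (intro gauss_nodes_if_ge[of "- b" "- a" "map uminus ts"]) auto
  then show ?thesis by auto
qed

text \<open>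
  The hypotheses make \<open>a\<close> and \<open>b\<close> the nodes of the two-point Gauss quadrature for the uniform
  measure on \<open>ts\<close>.
\<close>

lemma extreme_points_gauss_nodes:
  fixes a b :: real
  assumes s0: "(\<Sum>t\<leftarrow>ts. (t - a) * (t - b)) = 0"
    and s1: "(\<Sum>t\<leftarrow>ts. t * ((t - a) * (t - b))) = 0"
    and "a < b" and dec: "sorted_wrt (\<ge>) ts"
    and nonconst: "\<And>c. \<exists>t\<in>set ts. t \<noteq> c"
  shows "last ts \<le> a"
    and "last ts = a \<longleftrightarrow> (\<forall>t\<in>set ts. (t - a) * (t - b) = 0)"
    and "hd ts \<ge> b"
    and "hd ts = b \<longleftrightarrow> (\<forall>t\<in>set ts. (t - a) * (t - b) = 0)"
proof -
  have "ts \<noteq> []" using nonconst by auto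
  then have mem: "last ts \<in> set ts" "hd ts \<in> set ts" by auto
  have last: "last ts \<le> t" if "t \<in> set ts" for t
    using dec \<open>ts \<noteq> []\<close> that by (induction ts) auto
  have hd: "t \<le> hd ts" if "t \<in> set ts" for t
    using dec \<open>ts \<noteq> []\<close> that by (cases ts) auto
  have nodes: "t = a \<or> t = b" if "a \<le> last ts \<or> hd ts \<le> b" "t \<in> set ts" for t
    using that gauss_nodes_if_ge[OF s0 s1 _ that(2)] gauss_nodes_if_le[OF s0 s1 _ that(2)]
    by (meson hd last order_trans)
  show le: "last ts \<le> a"
  proof (rule ccontr)
    assume "\<not> last ts \<le> a"
    \<comment> \<open>If all points exceeded \<open>a\<close>, they would be nodes other than
      \<open>a\<close>, so the list would be constantly \<open>b\<close>.\<close>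
    then have "\<forall>t\<in>set ts. t = b" using nodes last by force
    then show False using nonconst[of b] by auto
  qed
  show ge: "hd ts \<ge> b"
  proof (rule ccontr)
    assume "\<not> hd ts \<ge> b"
    then have "\<forall>t\<in>set ts. t = a" using nodes hd by force
    then show False using nonconst[of a] by auto
  qed
  show "last ts = a \<longleftrightarrow> (\<forall>t\<in>set ts. (t - a) * (t - b) = 0)"
    using nodes mem le \<open>a < b\<close> by force
  show "hd ts = b \<longleftrightarrow> (\<forall>t\<in>set ts. (t - a) * (t - b) = 0)"
    using nodes mem ge \<open>a < b\<close> by force
qed

text \<open>A constant list attains equality in the Cauchy-Schwarz inequality, which the strict
  hypothesis excludes.\<close>

lemma not_constant_if_variance_pos:
  fixes ts :: "real list"
  assumes "(\<Sum>t\<leftarrow>ts. t)\<^sup>2 < (\<Sum>t\<leftarrow>ts. 1) * (\<Sum>t\<leftarrow>ts. t\<^sup>2)"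
  shows "\<exists>t\<in>set ts. t \<noteq> c"
proof (rule ccontr)
  assume "\<not> (\<exists>t\<in>set ts. t \<noteq> c)"
  then have "ts = replicate (length ts) c" by (simp add: replicate_length_same)
  then obtain m where "ts = replicate m c" ..
  then show False using assms by (simp add: sum_list_replicate power2_eq_square)
qed

section \<open>Regular graphs\<close>

text \<open>Double counting of the pairs \<open>(x, f x)\<close>. It serves to pass from arcs to
  edges and from ordered triples to triangles.\<close>

lemma card_eq_mult_fibres:
  assumes "finite X" "f ` X = Y" "\<And>y. y \<in> Y \<Longrightarrow> card {x \<in> X. f x = y} = c"
  shows "card X = c * card Y"
proof -
  have "(\<Sum>x\<in>X. card {y \<in> Y. f x = y}) = c * card Y"
    using assms by (intro sum_multicount) auto
  moreover have "card {y \<in> Y. f x = y} = 1" if "x \<in> X" for x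
  proof -
    have "{y \<in> Y. f x = y} = {f x}" using that assms(2) by auto
    then show ?thesis by simp
  qed
  ultimately show ?thesis by simp
qed

section \<open>Counting arcs, edges and triangles; complete multipartite graphs\<close>

context graph
begin

declare reachableE [rule del]

lemma adj_sym: "u \<rightarrow>\<^bsub>G\<^esub> v \<Longrightarrow> v \<rightarrow>\<^bsub>G\<^esub> u"
  by (rule arcs_ends_symmetric[OF sym_arcs])

lemma finite_arcs_ends: "finite (arcs_ends G)"
  by (simp add: arcs_ends_def)

text \<open>Without parallel arcs, an arc leaving \<open>u\<close> is determined by its
  head.\<close>

lemma card_neighbours: "card {v \<in> verts G. u \<rightarrow>\<^bsub>G\<^esub> v} = out_degree G u"
proof -
  have "inj_on (head G) (out_arcs G u)"
    by (rule inj_onI, rule no_multi_arcs) (auto simp: arc_to_ends_def)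
  moreover have "head G ` out_arcs G u = {v \<in> verts G. u \<rightarrow>\<^bsub>G\<^esub> v}"
    by (auto simp: arcs_ends_conv image_iff)
  ultimately have "bij_betw (head G) (out_arcs G u) {v \<in> verts G. u \<rightarrow>\<^bsub>G\<^esub> v}"
    by (simp add: bij_betw_def)
  then show ?thesis
    by (simp add: out_degree_def bij_betw_same_card)
qed

lemma card_arcs_ends: "card (arcs_ends G) = 2 * card (edges G)"
proof (rule card_eq_mult_fibres[where f = "\<lambda>(u, v). {u, v}"])
  fix e assume "e \<in> edges G"
  then obtain u v where e: "e = {u, v}" "u \<rightarrow>\<^bsub>G\<^esub> v" by (auto simp: edges_def)
  then have "u \<noteq> v" using adj_not_same by blast
  moreover have "{x \<in> arcs_ends G. (case x of (u, v) \<Rightarrow> {u, v}) = e} = {(u, v), (v, u)}"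
  proof (rule Set.set_eqI)
    fix x :: "'a \<times> 'a"
    obtain a b where x: "x = (a, b)" by (cases x)
    show "x \<in> {x \<in> arcs_ends G. (case x of (u, v) \<Rightarrow> {u, v}) = e} \<longleftrightarrow> x \<in> {(u, v), (v, u)}"
      unfolding x e(1) using e(2) adj_sym[OF e(2)] by (auto simp: doubleton_eq_iff)
  qed
  ultimately show "card {x \<in> arcs_ends G. (case x of (u, v) \<Rightarrow> {u, v}) = e} = 2" by simp
next
  show "(\<lambda>(u, v). {u, v}) ` arcs_ends G = edges G"
    unfolding edges_def by force
qed (rule finite_arcs_ends)

lemma card_triangle_triples:
  "card {(u, v, w). u \<rightarrow>\<^bsub>G\<^esub> v \<and> v \<rightarrow>\<^bsub>G\<^esub> w \<and> w \<rightarrow>\<^bsub>G\<^esub> u} = 6 * card (triangles G)"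
proof (rule card_eq_mult_fibres[where f = "\<lambda>(u, v, w). {u, v, w}"])
  let ?T = "{(u, v, w). u \<rightarrow>\<^bsub>G\<^esub> v \<and> v \<rightarrow>\<^bsub>G\<^esub> w \<and> w \<rightarrow>\<^bsub>G\<^esub> u}"
  show "finite ?T"
    by (rule finite_subset[of _ "verts G \<times> verts G \<times> verts G"]) (auto dest: adj_in_verts)
  fix t assume "t \<in> triangles G"
  then obtain a b c where t: "t = {a, b, c}" and adj: "a \<rightarrow>\<^bsub>G\<^esub> b" "b \<rightarrow>\<^bsub>G\<^esub> c" "c \<rightarrow>\<^bsub>G\<^esub> a"
    by (auto simp: triangles_def)
  then have neq: "a \<noteq> b" "b \<noteq> c" "c \<noteq> a" using adj_not_same by blast+
  \<comment> \<open>Adjacent vertices are distinct, so the ordered triples over a triangle are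
    exactly its six orderings.\<close>
  have "{x \<in> ?T. (case x of (u, v, w) \<Rightarrow> {u, v, w}) = t} =
      {(a, b, c), (a, c, b), (b, a, c), (b, c, a), (c, a, b), (c, b, a)}" (is "?L = ?R")
  proof
    show "?L \<subseteq> ?R"
    proof
      fix x assume "x \<in> ?L"
      then obtain u v w where x: "x = (u, v, w)" and uvw: "{u, v, w} = {a, b, c}"
        and "u \<rightarrow>\<^bsub>G\<^esub> v" "v \<rightarrow>\<^bsub>G\<^esub> w" "w \<rightarrow>\<^bsub>G\<^esub> u" by (auto simp: t)
      then have "u \<noteq> v" "v \<noteq> w" "w \<noteq> u" using adj_not_same by blast+
      moreover have "u \<in> {a, b, c}" "v \<in> {a, b, c}" "w \<in> {a, b, c}"
        using uvw by blast+
      ultimately show "x \<in> ?R" unfolding x by auto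
    qed
    show "?R \<subseteq> ?L"
      using adj adj[THEN adj_sym] unfolding t by auto
  qed
  then show "card {x \<in> ?T. (case x of (u, v, w) \<Rightarrow> {u, v, w}) = t} = 6"
    using neq by simp
next
  show "(\<lambda>(u, v, w). {u, v, w}) ` {(u, v, w). u \<rightarrow>\<^bsub>G\<^esub> v \<and> v \<rightarrow>\<^bsub>G\<^esub> w \<and> w \<rightarrow>\<^bsub>G\<^esub> u} = triangles G"
    unfolding triangles_def by force
qed

text \<open>An arc together with a common neighbour of its ends is an ordered triangle.\<close>

lemma sum_common_neighbours_arcs:
  "(\<Sum>(u, v)\<in>arcs_ends G. card (common_neighbours G u v)) = 6 * card (triangles G)"
proof -
  have iff: "w \<in> common_neighbours G u v \<longleftrightarrow> v \<rightarrow>\<^bsub>G\<^esub> w \<and> w \<rightarrow>\<^bsub>G\<^esub> u" for u v w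
    unfolding common_neighbours_def using adj_sym adj_in_verts by blast
  have "(\<Sum>x\<in>arcs_ends G. card (common_neighbours G (fst x) (snd x))) =
      card (SIGMA x : arcs_ends G. common_neighbours G (fst x) (snd x))"
    by (simp add: finite_arcs_ends common_neighbours_def)
  also have "\<dots> = card {(u, v, w). u \<rightarrow>\<^bsub>G\<^esub> v \<and> v \<rightarrow>\<^bsub>G\<^esub> w \<and> w \<rightarrow>\<^bsub>G\<^esub> u}"
    by (rule bij_betw_same_card[of "\<lambda>((u, v), w). (u, v, w)"],
        rule bij_betw_byWitness[where f' = "\<lambda>(u, v, w). ((u, v), w)"])
      (auto simp: iff)
  finally show ?thesis
    by (simp add: card_triangle_triples case_prod_beta)
qed

text \<open>Nonadjacency is reflexive and symmetric on the vertices. Were it also transitive, its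
  classes would be the parts of a complete multipartite graph; the triple is a failure of
  transitivity.\<close>

lemma not_complete_multipartiteE:
  assumes "\<not> complete_multipartite G"
  obtains x y z where "x \<rightarrow>\<^bsub>G\<^esub> z" "y \<in> verts G" "\<not> x \<rightarrow>\<^bsub>G\<^esub> y" "\<not> y \<rightarrow>\<^bsub>G\<^esub> z"
proof (rule ccontr)
  assume "\<not> thesis"
  with that have trans: "\<And>x y z. y \<in> verts G \<Longrightarrow> \<not> x \<rightarrow>\<^bsub>G\<^esub> y \<Longrightarrow> \<not> y \<rightarrow>\<^bsub>G\<^esub> z \<Longrightarrow> \<not> x \<rightarrow>\<^bsub>G\<^esub> z" by blast
  define R where "R = {(u, v). u \<in> verts G \<and> v \<in> verts G \<and> \<not> u \<rightarrow>\<^bsub>G\<^esub> v}"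
  have "equiv (verts G) R"
  proof (rule equivI)
    show "R \<subseteq> verts G \<times> verts G" by (auto simp: R_def)
    show "refl_on (verts G) R" using adj_not_same by (auto simp: R_def refl_on_def)
    show "sym R" unfolding R_def sym_def using adj_sym by blast
    show "trans R"
    proof (rule transI)
      fix u v w assume "(u, v) \<in> R" "(v, w) \<in> R"
      then show "(u, w) \<in> R" using trans[of v u w] by (simp add: R_def)
    qed
  qed
  then have "partition_on (verts G) (verts G // R)"
    by (rule partition_on_quotient)
  moreover have "u \<rightarrow>\<^bsub>G\<^esub> v \<longleftrightarrow> \<not> (\<exists>X\<in>verts G // R. u \<in> X \<and> v \<in> X)"
    if "u \<in> verts G" "v \<in> verts G" for u v
  proof -
    have "(\<exists>X\<in>verts G // R. u \<in> X \<and> v \<in> X) \<longleftrightarrow> (u, v) \<in> R"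
    proof
      assume "\<exists>X\<in>verts G // R. u \<in> X \<and> v \<in> X"
      then obtain X where "X \<in> verts G // R" "u \<in> X" "v \<in> X" by blast
      then show "(u, v) \<in> R"
        using quotient_eq_iff[OF \<open>equiv (verts G) R\<close>, of X X u v] by simp
    next
      assume "(u, v) \<in> R"
      then have "u \<in> R `` {u}" "v \<in> R `` {u}"
        using \<open>equiv (verts G) R\<close> that by (auto simp: equiv_def refl_on_def)
      then show "\<exists>X\<in>verts G // R. u \<in> X \<and> v \<in> X"
        using that by (intro bexI[of _ "R `` {u}"] conjI quotientI)
    qed
    then show ?thesis using that by (auto simp: R_def)
  qed
  ultimately show False
    using assms unfolding complete_multipartite_def by blast
qed

end

section \<open>Averaged parameters of regular graphs\<close>

context graph
begin

lemma card_arcs_ends_regular: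
  assumes "\<forall>u\<in>verts G. out_degree G u = k"
  shows "card (arcs_ends G) = card (verts G) * k"
proof -
  have "arcs_ends G = (SIGMA u : verts G. {v \<in> verts G. u \<rightarrow>\<^bsub>G\<^esub> v})"
    using adj_in_verts by auto
  then have "card (arcs_ends G) = card (SIGMA u : verts G. {v \<in> verts G. u \<rightarrow>\<^bsub>G\<^esub> v})"
    by (rule arg_cong)
  also have "\<dots> = card (verts G) * k"
    using assms by (simp add: card_neighbours)
  finally show ?thesis .
qed

lemma k_bar_regular:
  assumes "\<forall>u\<in>verts G. out_degree G u = k" and "verts G \<noteq> {}"
  shows "k_bar G = k"
  using card_arcs_ends_regular[OF assms(1)] card_arcs_ends assms(2)
  by (simp add: k_bar_def num_verts_def field_simps flip: of_nat_mult)

text \<open>Inclusion-exclusion for the two neighbourhoods; a vertex outside both makes the bound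
  strict.\<close>

lemma double_degree_le_common_neighbours:
  assumes deg: "\<forall>u\<in>verts G. out_degree G u = k"
    and "u \<in> verts G" "v \<in> verts G"
  shows "2 * k \<le> card (verts G) + card (common_neighbours G u v)"
    and "y \<in> verts G \<Longrightarrow> \<not> u \<rightarrow>\<^bsub>G\<^esub> y \<Longrightarrow> \<not> v \<rightarrow>\<^bsub>G\<^esub> y \<Longrightarrow>
      2 * k < card (verts G) + card (common_neighbours G u v)"
proof -
  define N where "N = (\<lambda>u. {w \<in> verts G. u \<rightarrow>\<^bsub>G\<^esub> w})"
  have "N u \<inter> N v = common_neighbours G u v"
    by (auto simp: N_def common_neighbours_def)
  then have card: "2 * k = card (N u \<union> N v) + card (common_neighbours G u v)"
    using card_Un_Int[of "N u" "N v"] assms card_neighbours by (simp add: N_def)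
  have sub: "N u \<union> N v \<subseteq> verts G" by (auto simp: N_def)
  show "2 * k \<le> card (verts G) + card (common_neighbours G u v)"
    unfolding card using card_mono[OF finite_verts sub] by simp
  assume "y \<in> verts G" "\<not> u \<rightarrow>\<^bsub>G\<^esub> y" "\<not> v \<rightarrow>\<^bsub>G\<^esub> y"
  then have "N u \<union> N v \<subset> verts G" using sub by (auto simp: N_def)
  then show "2 * k < card (verts G) + card (common_neighbours G u v)"
    using psubset_card_mono[OF finite_verts] card by simp
qed

text \<open>\<open>lambda_bar\<close> is the average number of common neighbours over all arcs,
  whose number is \<open>card (verts G) * k\<close>.\<close>

lemma lambda_bar_regular:
  assumes "\<forall>u\<in>verts G. out_degree G u = k" and "verts G \<noteq> {}" and "k > 0"
  shows "lambda_bar G * (card (verts G) * k) =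
    (\<Sum>(u, v)\<in>arcs_ends G. card (common_neighbours G u v))"
  using assms(2,3) unfolding sum_common_neighbours_arcs lambda_bar_def k_bar_regular[OF assms(1,2)]
  by (simp add: num_verts_def)

text \<open>These bounds make the denominators in \<open>s_bar\<close> and \<open>mu_bar\<close>
  positive, as \<open>theta_sum_prod\<close> requires. All come from an arc \<open>(x, z)\<close>
  and a vertex \<open>y\<close> adjacent to neither end.\<close>

lemma regular_not_complete_multipartite:
  assumes deg: "\<forall>u\<in>verts G. out_degree G u = k"
    and "\<not> complete_multipartite G"
  shows "verts G \<noteq> {}" and "k > 0" and "k + 1 < card (verts G)"
    and "card (verts G) + lambda_bar G - 2 * real k > 0"
proof -
  obtain x y z where xz: "x \<rightarrow>\<^bsub>G\<^esub> z" and y: "y \<in> verts G" "\<not> x \<rightarrow>\<^bsub>G\<^esub> y" "\<not> y \<rightarrow>\<^bsub>G\<^esub> z"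
    using assms(2) by (rule not_complete_multipartiteE)
  have x: "x \<in> verts G" and z: "z \<in> verts G" using adj_in_verts xz by auto
  show ne: "verts G \<noteq> {}" using x by auto
  have "z \<in> {v \<in> verts G. x \<rightarrow>\<^bsub>G\<^esub> v}" using xz z by simp
  then have "card {v \<in> verts G. x \<rightarrow>\<^bsub>G\<^esub> v} > 0" by (auto simp: card_gt_0_iff)
  then show k: "k > 0" using card_neighbours deg x by simp
  have "x \<noteq> y" using xz y by auto
  \<comment> \<open>The neighbourhood of \<open>y\<close> misses both \<open>x\<close> and
    \<open>y\<close>, so \<open>k\<close> is at most the number of vertices minus two.\<close>
  have "{v \<in> verts G. y \<rightarrow>\<^bsub>G\<^esub> v} \<subseteq> verts G - {x, y}"
    using y adj_sym adj_not_same by blast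
  from card_mono[OF _ this] have "k \<le> card (verts G - {x, y})"
    using card_neighbours deg y by simp
  moreover have "card {x, y} \<le> card (verts G)"
    using x y by (intro card_mono) auto
  ultimately show "k + 1 < card (verts G)"
    using x y \<open>x \<noteq> y\<close> by (simp add: card_Diff_subset)
  let ?f = "\<lambda>(u, v). real (card (verts G)) + card (common_neighbours G u v) - 2 * k"
  \<comment> \<open>Averaging \<open>?f\<close> over the arcs gives the quantity in question. No
    term is negative, and \<open>y\<close> makes the term of \<open>(x, z)\<close> positive.\<close>
  have "0 < sum ?f (arcs_ends G)"
  proof (rule sum_pos2)
    show "(x, z) \<in> arcs_ends G" by fact
    have "\<not> z \<rightarrow>\<^bsub>G\<^esub> y" using y adj_sym by blast
    then show "0 < ?f (x, z)"
      using double_degree_le_common_neighbours(2)[OF deg x z y(1,2)] by simp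
    fix a assume "a \<in> arcs_ends G"
    then show "0 \<le> ?f a"
      using double_degree_le_common_neighbours(1)[OF deg, of "fst a" "snd a"]
        adj_in_verts[of "fst a" "snd a"] by (simp add: case_prod_beta)
  qed (rule finite_arcs_ends)
  also have "sum ?f (arcs_ends G) = real (card (verts G) * k) * (card (verts G) + lambda_bar G - 2 * real k)"
    using lambda_bar_regular[OF deg ne k] card_arcs_ends_regular[OF deg]
    by (simp add: case_prod_beta sum.distrib sum_subtractf algebra_simps)
  finally have "0 < real (card (verts G) * k) * (card (verts G) + lambda_bar G - 2 * real k)" .
  moreover have "0 < real (card (verts G) * k)"
    unfolding of_nat_0_less_iff nat_0_less_mult_iff using k ne by (simp add: card_gt_0_iff)
  ultimately show "card (verts G) + lambda_bar G - 2 * real k > 0"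
    by (rule zero_less_mult_pos)
qed

end

section \<open>The adjacency matrix and its power sums\<close>

lemma adjacency_matrix_carrier [simp]:
  "adjacency_matrix G vs \<in> carrier_mat (length vs) (length vs)"
  by (simp add: adjacency_matrix_def)

lemma adjacency_matrix_index:
  "i < length vs \<Longrightarrow> j < length vs \<Longrightarrow>
    adjacency_matrix G vs $$ (i, j) = of_bool (vs ! i \<rightarrow>\<^bsub>G\<^esub> vs ! j)"
  by (simp add: adjacency_matrix_def)

lemma sum_nth_distinct:
  assumes "distinct vs"
  shows "(\<Sum>i<length vs. f (vs ! i)) = sum f (set vs)"
  using assms by (intro sum.reindex_bij_betw bij_betw_nth) auto

context graph
begin

lemma transpose_adjacency_matrix:
  "transpose_mat (adjacency_matrix G vs) = adjacency_matrix G vs"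
  using adj_sym by (intro eq_matI) (auto simp: adjacency_matrix_def)

context
  fixes vs :: "'a list" and k :: nat
  assumes vs: "distinct vs" "set vs = verts G"
    and deg: "\<forall>u\<in>verts G. out_degree G u = k"
begin

abbreviation "A \<equiv> adjacency_matrix G vs"
abbreviation "n \<equiv> length vs"

lemma length_vs: "n = card (verts G)"
  using vs distinct_card by metis

lemma adjacency_matrix_row_sum:
  assumes "i < n"
  shows "(\<Sum>j<n. A $$ (i, j)) = k"
proof -
  have "(\<Sum>j<n. A $$ (i, j)) = (\<Sum>j<n. of_bool (vs ! i \<rightarrow>\<^bsub>G\<^esub> vs ! j))"
    using assms by (intro sum.cong) (auto simp: adjacency_matrix_index)
  also have "\<dots> = (\<Sum>v\<in>verts G. of_bool (vs ! i \<rightarrow>\<^bsub>G\<^esub> v))"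
    unfolding vs(2)[symmetric] by (rule sum_nth_distinct[OF vs(1)])
  also have "\<dots> = card {v \<in> verts G. vs ! i \<rightarrow>\<^bsub>G\<^esub> v}"
    by (simp add: of_bool_def flip: sum.inter_filter)
  also have "\<dots> = k"
    using nth_mem[OF assms] vs(2) deg by (simp add: card_neighbours)
  finally show ?thesis .
qed

lemma adjacency_matrix_square_index:
  assumes "i < n" "j < n"
  shows "(A ^\<^sub>m 2) $$ (i, j) = card (common_neighbours G (vs ! i) (vs ! j))"
proof -
  have "(A ^\<^sub>m 2) $$ (i, j) = (\<Sum>l<n. A $$ (i, l) * A $$ (l, j))"
    using assms by (simp add: numeral_2_eq_2 index_mult_mat_sum[of _ n n _ n] del: index_mult_mat)
  also have "\<dots> = (\<Sum>l<n. of_bool (vs ! i \<rightarrow>\<^bsub>G\<^esub> vs ! l \<and> vs ! j \<rightarrow>\<^bsub>G\<^esub> vs ! l))"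
    using assms adj_sym by (intro sum.cong refl) (force simp: adjacency_matrix_index)
  also have "\<dots> = (\<Sum>w\<in>verts G. of_bool (vs ! i \<rightarrow>\<^bsub>G\<^esub> w \<and> vs ! j \<rightarrow>\<^bsub>G\<^esub> w))"
    unfolding vs(2)[symmetric]
    by (rule sum_nth_distinct[OF vs(1), of "\<lambda>w. of_bool (vs ! i \<rightarrow>\<^bsub>G\<^esub> w \<and> vs ! j \<rightarrow>\<^bsub>G\<^esub> w)"])
  also have "\<dots> = card (common_neighbours G (vs ! i) (vs ! j))"
    by (simp add: of_bool_def common_neighbours_def flip: sum.inter_filter)
  finally show ?thesis .
qed

text \<open>By \<open>frobenius_pow_symmetric\<close> the left side is the trace of the cube, which
  is thus expressed through triangles without computing entries of the cube.\<close>

lemma frobenius_adjacency_matrix_square: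
  "(\<Sum>i<n. \<Sum>j<n. (A ^\<^sub>m 2) $$ (i, j) * A $$ (i, j)) =
    (\<Sum>(u, v)\<in>arcs_ends G. card (common_neighbours G u v))"
proof -
  let ?g = "\<lambda>u v. if u \<rightarrow>\<^bsub>G\<^esub> v then real (card (common_neighbours G u v)) else 0"
  have "(\<Sum>i<n. \<Sum>j<n. (A ^\<^sub>m 2) $$ (i, j) * A $$ (i, j)) = (\<Sum>i<n. \<Sum>j<n. ?g (vs ! i) (vs ! j))"
    by (intro sum.cong refl) (simp add: adjacency_matrix_square_index adjacency_matrix_index)
  also have "\<dots> = (\<Sum>i<n. \<Sum>v\<in>verts G. ?g (vs ! i) v)"
    unfolding vs(2)[symmetric] by (intro sum.cong refl sum_nth_distinct[OF vs(1)])
  also have "\<dots> = (\<Sum>u\<in>verts G. \<Sum>v\<in>verts G. ?g u v)"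
    unfolding vs(2)[symmetric]
    by (rule sum_nth_distinct[OF vs(1), of "\<lambda>u. \<Sum>v\<in>set vs. ?g u v"])
  also have "\<dots> = (\<Sum>x\<in>verts G \<times> verts G. ?g (fst x) (snd x))"
    by (simp add: sum.cartesian_product case_prod_beta)
  also have "\<dots> = (\<Sum>x\<in>arcs_ends G. ?g (fst x) (snd x))"
    using adj_in_verts by (intro sum.mono_neutral_right) auto
  also have "\<dots> = (\<Sum>(u, v)\<in>arcs_ends G. card (common_neighbours G u v))"
    by (auto intro!: sum.cong)
  finally show ?thesis .
qed

text \<open>The traces of the powers with exponents 0 to 3, each less the contribution of the
  principal eigenvalue \<open>k\<close>. They count vertices, loops, arcs and ordered
  triangles.\<close>

lemma eigenvalue_power_sums:
  fixes ts :: "real list"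
  assumes "verts G \<noteq> {}" "k > 0" and es: "eigenvalue_list A = k # ts"
  shows "(\<Sum>t\<leftarrow>ts. 1) = real n - 1" "(\<Sum>t\<leftarrow>ts. t) = - real k"
    and "(\<Sum>t\<leftarrow>ts. t\<^sup>2) = real n * k - k\<^sup>2"
    and "(\<Sum>t\<leftarrow>ts. t ^ 3) = real n * k * lambda_bar G - k ^ 3"
proof -
  note sym = transpose_adjacency_matrix[of vs]
  have cp: "char_poly A = (\<Prod>e \<leftarrow> real k # ts. [:- e, 1:])"
    and len: "length (real k # ts) = n"
    using eigenvalue_list_of_symmetric[OF adjacency_matrix_carrier sym] es by auto
  note tr = trace_pow_eq_power_sum[OF adjacency_matrix_carrier cp]
  show "(\<Sum>t\<leftarrow>ts. 1) = real n - 1" using len by (simp add: sum_list_triv flip: len)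
  have "(\<Sum>i<n. (A ^\<^sub>m 1) $$ (i, i)) = 0"
    using adj_not_same by (auto simp: adjacency_matrix_index intro!: sum.neutral)
  then show "(\<Sum>t\<leftarrow>ts. t) = - real k"
    unfolding tr by simp
  have "(\<Sum>i<n. (A ^\<^sub>m 2) $$ (i, i)) = (\<Sum>i<n. real k)"
    using nth_mem[of _ vs] vs(2) deg
    by (intro sum.cong refl)
      (simp add: adjacency_matrix_square_index common_neighbours_def card_neighbours)
  then show "(\<Sum>t\<leftarrow>ts. t\<^sup>2) = real n * k - k\<^sup>2"
    unfolding tr by simp
  have "(\<Sum>i<n. \<Sum>j<n. (A ^\<^sub>m 2) $$ (i, j) * (A ^\<^sub>m 1) $$ (i, j)) = (\<Sum>e\<leftarrow>real k # ts. e ^ 3)"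
    using frobenius_pow_symmetric[OF adjacency_matrix_carrier sym, of 2 1] tr[of 3] by simp
  then show "(\<Sum>t\<leftarrow>ts. t ^ 3) = real n * k * lambda_bar G - k ^ 3"
    using frobenius_adjacency_matrix_square lambda_bar_regular[OF deg assms(1,2)]
    by (simp add: length_vs algebra_simps)
qed

end

end

lemma sum_squares_eq_0_iff:
  fixes f :: "'a \<Rightarrow> 'b \<Rightarrow> real"
  assumes "finite I" "finite J"
  shows "(\<Sum>i\<in>I. \<Sum>j\<in>J. (f i j)\<^sup>2) = 0 \<longleftrightarrow> (\<forall>i\<in>I. \<forall>j\<in>J. f i j = 0)"
  using assms by (simp add: sum_nonneg_eq_0_iff sum_nonneg)

lemma sum_list_squares_eq_0_iff:
  fixes f :: "'a \<Rightarrow> real"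
  shows "(\<Sum>x\<leftarrow>xs. (f x)\<^sup>2) = 0 \<longleftrightarrow> (\<forall>x\<in>set xs. f x = 0)"
  by (subst sum_list_nonneg_eq_0_iff) auto

section \<open>Strong regularity as a condition on the spectrum\<close>

context graph
begin

text \<open>A constant number of common neighbours over arcs equals its average. For
  \<open>mu_bar\<close>, walks of length two from a fixed vertex \<open>u\<close> are counted by
  middle vertex and by end vertex.\<close>

lemma strongly_regular_parameters:
  assumes deg: "\<forall>u\<in>verts G. out_degree G u = k" and "verts G \<noteq> {}" "k > 0" "k + 1 < card (verts G)"
    and adj: "\<forall>u\<in>verts G. \<forall>v\<in>verts G. u \<rightarrow>\<^bsub>G\<^esub> v \<longrightarrow> card (common_neighbours G u v) = l"
    and nonadj: "\<forall>u\<in>verts G. \<forall>v\<in>verts G. u \<noteq> v \<and> \<not> u \<rightarrow>\<^bsub>G\<^esub> v \<longrightarrow> card (common_neighbours G u v) = m"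
  shows "lambda_bar G = l" and "mu_bar G = m"
proof -
  have k: "k_bar G = k" and v: "num_verts G = card (verts G)"
    using k_bar_regular deg assms(2) by (auto simp: num_verts_def)
  have "(\<Sum>(u, v)\<in>arcs_ends G. card (common_neighbours G u v)) = (\<Sum>x\<in>arcs_ends G. l)"
    using adj adj_in_verts by (intro sum.cong) auto
  then have "(\<Sum>(u, v)\<in>arcs_ends G. card (common_neighbours G u v)) = card (verts G) * k * l"
    using card_arcs_ends_regular[OF deg] by simp
  then have "lambda_bar G * (card (verts G) * k) = real l * (card (verts G) * k)"
    using lambda_bar_regular[OF deg assms(2,3)] by simp
  then show l: "lambda_bar G = l" using assms(2-4) by simp
  obtain u where u: "u \<in> verts G" using assms(2) by auto
  let ?N = "{v \<in> verts G. u \<rightarrow>\<^bsub>G\<^esub> v}"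
  have cardN: "card ?N = k" using card_neighbours deg u by simp
  have uN: "u \<notin> ?N" using adj_not_same by auto
  have "(\<Sum>v\<in>verts G. card (common_neighbours G u v)) =
      (\<Sum>v\<in>verts G. card {w \<in> ?N. v \<rightarrow>\<^bsub>G\<^esub> w})"
    by (intro sum.cong refl arg_cong[of _ _ card]) (auto simp: common_neighbours_def)
  also have "\<dots> = k * card ?N"
  proof (rule sum_multicount)
    show "\<forall>w\<in>?N. card {v \<in> verts G. v \<rightarrow>\<^bsub>G\<^esub> w} = k"
    proof
      fix w assume w: "w \<in> ?N"
      have "{v \<in> verts G. v \<rightarrow>\<^bsub>G\<^esub> w} = {v \<in> verts G. w \<rightarrow>\<^bsub>G\<^esub> v}" using adj_sym by blast
      then show "card {v \<in> verts G. v \<rightarrow>\<^bsub>G\<^esub> w} = k" using card_neighbours deg w by simp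
    qed
  qed auto
  finally have "k * k = (\<Sum>v\<in>verts G. card (common_neighbours G u v))" using cardN by simp
  \<comment> \<open>The end vertices are \<open>u\<close> itself, its \<open>k\<close> neighbours
    and the remaining vertices, contributing \<open>k\<close>, \<open>k * l\<close> and
    \<open>m\<close> for each remaining vertex.\<close>
  also have "\<dots> = (\<Sum>v\<in>insert u ?N. card (common_neighbours G u v)) +
      (\<Sum>v\<in>verts G - insert u ?N. card (common_neighbours G u v))"
    by (subst add.commute, rule sum.subset_diff) (use u in auto)
  also have "(\<Sum>v\<in>verts G - insert u ?N. card (common_neighbours G u v)) =
      (\<Sum>v\<in>verts G - insert u ?N. m)"
  proof (rule sum.cong)
    fix v assume "v \<in> verts G - insert u ?N"
    then have "v \<in> verts G" "u \<noteq> v \<and> \<not> u \<rightarrow>\<^bsub>G\<^esub> v" by auto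
    then show "card (common_neighbours G u v) = m" using u nonadj by simp
  qed simp
  also have "\<dots> = (card (verts G) - (k + 1)) * m"
    using u uN cardN by (simp add: card_Diff_subset)
  also have "(\<Sum>v\<in>insert u ?N. card (common_neighbours G u v)) =
      card (common_neighbours G u u) + (\<Sum>v\<in>?N. l)"
    using u uN adj by (subst sum.insert) auto
  also have "card (common_neighbours G u u) = k"
    using cardN by (simp add: common_neighbours_def)
  finally have "k * k = k + k * l + (card (verts G) - (k + 1)) * m"
    using cardN by simp
  then have "real (k * k) = real (k + k * l + (card (verts G) - (k + 1)) * m)" by simp
  then have "real k * k = k + real k * l + (real (card (verts G)) - (k + 1)) * m"
    using assms(4) by (simp add: of_nat_diff)
  then show "mu_bar G = m"
    unfolding mu_bar_def k l v using assms(4) by (simp add: field_simps)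
qed

text \<open>By \<open>frobenius_quadratic_minus_const\<close> the quadratic vanishes on
  \<open>ts\<close> if and only if all entries of \<open>M\<close> equal \<open>c\<close>. Off the
  diagonal, these entries are numbers of common neighbours, shifted by \<open>s\<close> at adjacent
  pairs.\<close>

lemma strongly_regular_iff_quadratic:
  fixes vs :: "'a list" and ts :: "real list"
  assumes vs: "distinct vs" "set vs = verts G"
    and deg: "\<forall>u\<in>verts G. out_degree G u = k"
    and "verts G \<noteq> {}" "k > 0" "k + 1 < card (verts G)"
    and es: "eigenvalue_list (adjacency_matrix G vs) = k # ts"
  shows "strongly_regular G \<longleftrightarrow>
    (\<forall>t\<in>set ts. t\<^sup>2 - (lambda_bar G - mu_bar G) * t + (mu_bar G - k) = 0)"
proof -
  define A where "A = adjacency_matrix G vs"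
  define n where "n = length vs"
  define s where "s = lambda_bar G - mu_bar G"
  define p where "p = mu_bar G - k"
  define c where "c = ((real k)\<^sup>2 - s * k + p) / n"
  define M where "M i j = (A ^\<^sub>m 2) $$ (i, j) - s * A $$ (i, j) + p * (1\<^sub>m n) $$ (i, j)" for i j
  have n: "n = card (verts G)" "n > 0"
    using length_vs[OF vs deg] assms(6) by (auto simp: n_def)
  have A: "A \<in> carrier_mat n n" and sym: "transpose_mat A = A"
    by (auto simp: A_def n_def transpose_adjacency_matrix)
  have row: "(\<Sum>j<n. A $$ (i, j)) = k" if "i < n" for i
    using adjacency_matrix_row_sum[OF vs deg] that by (simp add: A_def n_def)
  have cp: "char_poly A = (\<Prod>e \<leftarrow> real k # ts. [:- e, 1:])"
    using eigenvalue_list_of_symmetric(1)[OF A sym] es by (simp add: A_def)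
  have entry: "M i j = card (common_neighbours G (vs ! i) (vs ! j))
      - s * of_bool (vs ! i \<rightarrow>\<^bsub>G\<^esub> vs ! j) + p * of_bool (vs ! i = vs ! j)"
    if "i < n" "j < n" for i j
    using that nth_eq_iff_index_eq[OF vs(1)] adjacency_matrix_square_index[OF vs deg]
    by (simp add: M_def A_def n_def adjacency_matrix_index)
  have cn_self: "card (common_neighbours G u u) = k" if "u \<in> verts G" for u
    using that deg card_neighbours by (simp add: common_neighbours_def)
  have frob: "(\<Sum>i<n. \<Sum>j<n. (M i j - c)\<^sup>2) = (\<Sum>t\<leftarrow>ts. (t\<^sup>2 - s * t + p)\<^sup>2)"
    unfolding M_def c_def by (rule frobenius_quadratic_minus_const[OF A sym n(2) row cp])
  have "(\<forall>t\<in>set ts. t\<^sup>2 - s * t + p = 0) \<longleftrightarrow> (\<forall>i<n. \<forall>j<n. M i j = c)"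
    using frob sum_list_squares_eq_0_iff[of "\<lambda>t. t\<^sup>2 - s * t + p" ts]
      sum_squares_eq_0_iff[of "{..<n}" "{..<n}" "\<lambda>i j. M i j - c"] by (simp add: Ball_def)
  also have "\<dots> \<longleftrightarrow> strongly_regular G"
  proof
    assume const: "\<forall>i<n. \<forall>j<n. M i j = c"
    have cn: "card (common_neighbours G u v) - s * of_bool (u \<rightarrow>\<^bsub>G\<^esub> v) + p * of_bool (u = v) = c"
      if uv: "u \<in> verts G" "v \<in> verts G" for u v
    proof -
      obtain i j where "i < n" "j < n" "u = vs ! i" "v = vs ! j"
        using uv unfolding vs(2)[symmetric] n_def by (auto simp: in_set_conv_nth)
      then show ?thesis using entry const by metis
    qed
    \<comment> \<open>The parameters must be natural numbers independent of the pair; the real value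
      is already a cardinality, so rounding changes nothing.\<close>
    have "card (common_neighbours G u v) = nat \<lfloor>c + s\<rfloor>"
      if "u \<in> verts G" "v \<in> verts G" "u \<rightarrow>\<^bsub>G\<^esub> v" for u v
    proof -
      have "real (card (common_neighbours G u v)) = c + s"
        using cn[of u v] that adj_not_same by auto
      then show ?thesis by linarith
    qed
    moreover have "card (common_neighbours G u v) = nat \<lfloor>c\<rfloor>"
      if "u \<in> verts G" "v \<in> verts G" "u \<noteq> v" "\<not> u \<rightarrow>\<^bsub>G\<^esub> v" for u v
    proof -
      have "real (card (common_neighbours G u v)) = c"
        using cn[of u v] that by auto
      then show ?thesis by linarith
    qed
    ultimately show "strongly_regular G"
      unfolding strongly_regular_def using deg by blast
  next
    assume "strongly_regular G"
    then obtain k' l m where deg': "\<forall>u\<in>verts G. out_degree G u = k'"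
      and adj: "\<forall>u\<in>verts G. \<forall>v\<in>verts G. u \<rightarrow>\<^bsub>G\<^esub> v \<longrightarrow> card (common_neighbours G u v) = l"
      and nonadj: "\<forall>u\<in>verts G. \<forall>v\<in>verts G. u \<noteq> v \<and> \<not> u \<rightarrow>\<^bsub>G\<^esub> v \<longrightarrow>
        card (common_neighbours G u v) = m"
      unfolding strongly_regular_def by blast
    have l: "lambda_bar G = l" and m: "mu_bar G = m"
      using strongly_regular_parameters[OF deg assms(4-6) adj nonadj] .
    \<comment> \<open>Diagonal entries are \<open>k + (m - k)\<close>, entries at adjacent pairs are
      \<open>l - (l - m)\<close>, and all others are \<open>m\<close>.\<close>
    have M: "M i j = m" if "i < n" "j < n" for i j
    proof -
      have mem: "vs ! i \<in> verts G" "vs ! j \<in> verts G"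
        using that vs(2) n_def nth_mem by auto
      have "\<not> vs ! i \<rightarrow>\<^bsub>G\<^esub> vs ! i" using adj_not_same by blast
      then show ?thesis
        using entry[OF that] cn_self mem adj nonadj
        by (cases "vs ! i = vs ! j"; cases "vs ! i \<rightarrow>\<^bsub>G\<^esub> vs ! j") (auto simp: s_def p_def l m)
    qed
    \<comment> \<open>Summing row 0 of \<open>M\<close> in two ways identifies the constant
      \<open>c\<close> as \<open>m\<close>.\<close>
    have "(real k)\<^sup>2 - s * k + p = n * m"
    proof -
      have "n * m = (\<Sum>j<n. M 0 j)" using M n(2) by simp
      also have "\<dots> = (real k)\<^sup>2 - s * k + p"
        using row_sum_pow_mat[OF A row, of 0 2] row[of 0] n(2)
        by (simp add: M_def sum.distrib sum_subtractf one_mat_def flip: sum_distrib_left del: pow_mat.simps)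
      finally show ?thesis by simp
    qed
    then show "\<forall>i<n. \<forall>j<n. M i j = c"
      using M n(2) by (simp add: c_def)
  qed
  finally show ?thesis unfolding s_def p_def by blast
qed

end

section \<open>The eigenvalue bounds\<close>

theorem theorem2p14:
  fixes G :: "('a, 'b) pre_digraph" and vs :: "'a list"
  assumes "graph G"
    and "Digraph_Component.connected G"
    and "regular G"
    and "\<not> complete_multipartite G"
    and "distinct vs" and "set vs = verts G"
  shows "(theta_min (adjacency_matrix G vs) \<le> theta_m G
          \<and> (theta_min (adjacency_matrix G vs) = theta_m G \<longleftrightarrow> strongly_regular G))
       \<and> (theta_Max2 (adjacency_matrix G vs) \<ge> theta_M G
          \<and> (theta_Max2 (adjacency_matrix G vs) = theta_M G \<longleftrightarrow> strongly_regular G))"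
proof -
  interpret graph G by fact
  note vs = assms(5,6)
  obtain k where deg: "\<forall>u\<in>verts G. out_degree G u = k"
    using assms(3) by (auto simp: regular_def)
  note basic = regular_not_complete_multipartite[OF deg assms(4)]
  define A where "A = adjacency_matrix G vs"
  define n where "n = length vs"
  define l where "l = lambda_bar G"
  define m where "m = mu_bar G"
  define a where "a = theta_m G"
  define b where "b = theta_M G"
  have n: "n = card (verts G)"
    using length_vs[OF vs deg] by (simp add: n_def)
  have kb: "k_bar G = k" and v: "num_verts G = n"
    using k_bar_regular deg basic(1) n by (auto simp: num_verts_def)
  have pos: "real k > 0" "real n - k - 1 > 0" "n + l - 2 * real k > 0"
    using basic n by (auto simp: l_def)
  have m: "m = k * (k - l - 1) / (real n - k - 1)"
    by (simp add: m_def mu_bar_def kb v l_def)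
  have theta: "a + b = l - m" "a * b = m - k" "a < 0" "b > 0"
    unfolding a_def b_def theta_m_def theta_M_def s_bar_def Let_def kb v l_def[symmetric] m_def[symmetric]
    by (rule theta_sum_prod[OF pos, folded m])+
  have A: "A \<in> carrier_mat n n" and sym: "transpose_mat A = A"
    by (auto simp: A_def n_def transpose_adjacency_matrix)
  have nonneg: "A $$ (i, j) \<ge> 0" if "i < n" "j < n" for i j
    using that by (simp add: A_def n_def adjacency_matrix_index)
  have row: "(\<Sum>j<n. A $$ (i, j)) = k" if "i < n" for i
    using adjacency_matrix_row_sum[OF vs deg] that by (simp add: A_def n_def)
  have "n > 0" using basic(3) n by simp
  then obtain ts where es: "eigenvalue_list A = real k # ts"
    using eigenvalue_list_row_sum[OF A sym _ nonneg row] by blast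
  have power_sums: "(\<Sum>t\<leftarrow>ts. 1) = real n - 1" "(\<Sum>t\<leftarrow>ts. t) = - real k"
    "(\<Sum>t\<leftarrow>ts. t\<^sup>2) = real n * k - (real k)\<^sup>2" "(\<Sum>t\<leftarrow>ts. t ^ 3) = real n * k * l - real k ^ 3"
    using eigenvalue_power_sums[OF vs deg basic(1,2), of ts] es by (auto simp: A_def n_def l_def)
  have q: "(t - a) * (t - b) = t\<^sup>2 - (l - m) * t + (m - k)" for t
    unfolding theta(1,2)[symmetric] by (simp add: power2_eq_square algebra_simps)
  \<comment> \<open>This relation defining \<open>mu_bar\<close> is all that both orthogonality sums
    reduce to: the first equals the difference of the two sides, the second \<open>k\<close> times
    that difference.\<close>
  have mk: "m * (real n - k - 1) = k * (k - l - 1)" using pos m by simp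
  have "(\<Sum>t\<leftarrow>ts. (t - a) * (t - b)) =
      (\<Sum>t\<leftarrow>ts. t\<^sup>2) - (l - m) * (\<Sum>t\<leftarrow>ts. t) + (m - k) * (\<Sum>t\<leftarrow>ts. 1)"
    unfolding sum_list_const_mult[symmetric] sum_list_addf[symmetric] sum_list_subtractf[symmetric] q
    by simp
  also have "\<dots> = 0"
    unfolding power_sums using mk by (simp add: power2_eq_square algebra_simps)
  finally have s0: "(\<Sum>t\<leftarrow>ts. (t - a) * (t - b)) = 0" .
  have "(\<Sum>t\<leftarrow>ts. t * ((t - a) * (t - b))) =
      (\<Sum>t\<leftarrow>ts. t ^ 3) - (l - m) * (\<Sum>t\<leftarrow>ts. t\<^sup>2) + (m - k) * (\<Sum>t\<leftarrow>ts. t)"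
    unfolding sum_list_const_mult[symmetric] sum_list_addf[symmetric] sum_list_subtractf[symmetric] q
    by (intro arg_cong[of _ _ sum_list] map_cong refl) (simp add: eval_nat_numeral algebra_simps)
  also have "\<dots> = k * (m * (real n - k - 1) - k * (k - l - 1))"
    unfolding power_sums by (simp add: eval_nat_numeral algebra_simps)
  also have "\<dots> = 0" using mk by simp
  finally have s1: "(\<Sum>t\<leftarrow>ts. t * ((t - a) * (t - b))) = 0" .
  \<comment> \<open>The variance of the non-principal eigenvalues is positive up to scaling, so they
    are not all equal.\<close>
  have "(real n - 1) * (real n * k - (real k)\<^sup>2) - (- real k)\<^sup>2 = real n * k * (real n - k - 1)"
    by (simp add: power2_eq_square algebra_simps)
  also have "\<dots> > 0" using pos by simp
  finally have nonconst: "\<exists>t\<in>set ts. t \<noteq> c" for c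
    by (intro not_constant_if_variance_pos, unfold power_sums) simp
  have dec: "sorted_wrt (\<ge>) ts"
    using sorted_wrt_eigenvalue_list[of A] es by simp
  have srg: "strongly_regular G \<longleftrightarrow> (\<forall>t\<in>set ts. (t - a) * (t - b) = 0)"
    using strongly_regular_iff_quadratic[OF vs deg basic(1-3), of ts] es
    by (simp add: q A_def l_def m_def)
  \<comment> \<open>With \<open>ts\<close> nonempty, the last entry of the full list is that of
    \<open>ts\<close>, and its entry at index 1 is the head of \<open>ts\<close>.\<close>
  have "ts \<noteq> []" using nonconst by auto
  then have "theta_min A = last ts" "theta_Max2 A = hd ts"
    by (auto simp: theta_min_def theta_Max2_def es hd_conv_nth)
  then show ?thesis
    using extreme_points_gauss_nodes[OF s0 s1 _ dec nonconst] theta(3,4) srg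
    unfolding A_def a_def b_def by simp
qed

end
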